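(* Let $n\ge 1$ and let $(A,B)$ be an orthogonal pair of hypergraphs (not necessarily uniform) with $\bigcup A=\bigcup B=[n]$. For $1\le i\le n$ let $\mathbb{L}_i=(A_i,B_i)$ be an $(r_i,s_i)$-loom, where the vertex sets of $\mathbb{L}_1,\dots,\mathbb{L}_n$ are pairwise disjoint. Let $(C,D)=(A,B)[\mathbb{L}_1,\dots,\mathbb{L}_n]$ be the blow-up. Suppose that: (1) $C$ and $D$ are uniform, say $C$ is $c$-uniform and $D$ is $d$-uniform; (2) for every (inclusion-)minimal cover $f$ of $A$ that is not in $B$, $\sum_{j\in f}s_j>d$; (3) for every (inclusion-)minimal cover $e$ of $B$ that is not in $A$, $\sum_{i\in e}r_i>c$. Then $(C,D)$ is a $(c,d)$-loom.
   Context: All hypergraphs are finite. A hypergraph $H$ is a set of subsets (edges) of a set $V(H)$, with $V(H)=\bigcup_{e\in H}e$; it is $r$-uniform if all its edges have size $r$. A cover of $H$ is a set $K\subseteq V(H)$ meeting every edge of $H$; $\tau(H)$ is the minimum size of a cover, and $C_k(H)$ is the set of covers of $H$ of size exactly $k$. A pair $(A,B)$ of hypergraphs is orthogonal if $|a\cap b|=1$ for all $a\in A$, $b\in B$. For integers $r,s\ge 1$, an $(r,s)$-loom is a pair $(A,B)$ of orthogonal hypergraphs such that $A$ is $r$-uniform, $B$ is $s$-uniform, $\tau(A)=s$, $\tau(B)=r$, $A=C_r(B)$ and $B=C_s(A)$; then $V(A)=V(B)$, and this set is the vertex set of the loom. For hypergraphs $H_1,\dots,H_k$ on pairwise disjoint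 vertex sets, the join is $H_1*\cdots*H_k=\{e_1\cup\cdots\cup e_k : e_i\in H_i\}$. Blow-up: given a pair $(A,B)$ of hypergraphs with $\bigcup A=\bigcup B=[n]=\{1,\dots,n\}$ and pairs of hypergraphs $(A_i,B_i)$, $1\le i\le n$, on pairwise disjoint vertex sets, the blow-up $(A,B)[(A_1,B_1),\dots,(A_n,B_n)]$ is the pair $(C,D)$ with $$C=\bigcup\{A_{i_1}*\cdots*A_{i_p} : \{i_1,\dots,i_p\}\in A\},\qquad D=\bigcup\{B_{j_1}*\cdots*B_{j_q} : \{j_1,\dots,j_q\}\in B\}.$$ *)

theory Defs
  imports Main "HOL-Library.Disjoint_Sets"
begin

text \<open>A hypergraph is identified with its set of edges, so its vertex set is \<open>\<Union>H\<close>.\<close>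

definition hypergraph :: "'a set set \<Rightarrow> bool" where
  "hypergraph H \<longleftrightarrow> finite H \<and> (\<forall>e\<in>H. finite e)"

definition uniform :: "nat \<Rightarrow> 'a set set \<Rightarrow> bool" where
  "uniform r H \<longleftrightarrow> (\<forall>e\<in>H. card e = r)"

definition cover :: "'a set set \<Rightarrow> 'a set \<Rightarrow> bool" where
  "cover H K \<longleftrightarrow> K \<subseteq> \<Union>H \<and> (\<forall>e\<in>H. K \<inter> e \<noteq> {})"

definition minimal_cover :: "'a set set \<Rightarrow> 'a set \<Rightarrow> bool" where
  "minimal_cover H K \<longleftrightarrow> cover H K \<and> (\<forall>K'. K' \<subset> K \<longrightarrow> \<not> cover H K')"

text \<open>A hypergraph has a cover iff the empty set is not one of its edges; only then is the
  following number meaningful.\<close>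

definition cover_number :: "'a set set \<Rightarrow> nat" where
  "cover_number H = (LEAST k. \<exists>K. cover H K \<and> card K = k)"

definition covers_of_size :: "nat \<Rightarrow> 'a set set \<Rightarrow> 'a set set" where
  "covers_of_size k H = {K. cover H K \<and> card K = k}"

fun orthogonal :: "'a set set \<times> 'a set set \<Rightarrow> bool" where
  "orthogonal (A, B) \<longleftrightarrow> (\<forall>a\<in>A. \<forall>b\<in>B. card (a \<inter> b) = 1)"

fun loom :: "nat \<Rightarrow> nat \<Rightarrow> 'a set set \<times> 'a set set \<Rightarrow> bool" where
  "loom r s (A, B) \<longleftrightarrow>
     r \<ge> 1 \<and> s \<ge> 1 \<and> hypergraph A \<and> hypergraph B \<and> orthogonal (A, B) \<and>
     uniform r A \<and> uniform s B \<and> cover_number A = s \<and> cover_number B = r \<and>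
     A = covers_of_size r B \<and> B = covers_of_size s A"

text \<open>The join of the family \<open>(H i)\<^sub>i\<close> over an index set \<open>I\<close>; \<open>e\<close> chooses an edge of each
  member. It is only meant for members with pairwise disjoint vertex sets.\<close>

definition join :: "'i set \<Rightarrow> ('i \<Rightarrow> 'a set set) \<Rightarrow> 'a set set" where
  "join I H = {\<Union>i\<in>I. e i | e. \<forall>i\<in>I. e i \<in> H i}"

fun blow_up :: "'i set set \<times> 'i set set \<Rightarrow> ('i \<Rightarrow> 'a set set \<times> 'a set set) \<Rightarrow>
    'a set set \<times> 'a set set" where
  "blow_up (A, B) L =
     (\<Union>a\<in>A. join a (\<lambda>i. fst (L i)), \<Union>b\<in>B. join b (\<lambda>j. snd (L j)))"

text \<open>Both sides of a loom have the same union, so the choice of the first one is immaterial.\<close>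

definition loom_vertices :: "'a set set \<times> 'a set set \<Rightarrow> 'a set" where
  "loom_vertices L = \<Union>(fst L)"

end

theory Submission
  imports Defs
begin

text \<open>The point is to show that \<open>D\<close> consists of the covers of \<open>C\<close> of minimum size; the other half
  is symmetric. Given a cover \<open>K\<close> of \<open>C\<close>, the indices \<open>i\<close> for which \<open>K\<close> restricts to a cover of
  \<open>A\<^sub>i\<close> form a cover of \<open>A\<close>: otherwise an edge of \<open>A\<close> avoiding them yields an edge of \<open>C\<close>
  missed by \<open>K\<close>. For a minimal cover \<open>f\<close> of \<open>A\<close> contained in this set,
  \<open>card K \<ge> (\<Sum>i\<in>f. s i)\<close>, which exceeds \<open>d\<close> unless \<open>f \<in> B\<close>, and is \<open>d\<close> otherwise. In the case
  of equality \<open>K\<close> is the union over \<open>f\<close> of minimum covers of the \<open>A\<^sub>i\<close>, hence an edge of \<open>D\<close>.\<close>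

text \<open>The mutually recursive equations between \<open>A\<close> and \<open>B\<close> in a loom make the simplifier loop.\<close>

declare loom.simps [simp del]

section \<open>Looms and minimal covers\<close>

lemma loomD:
  assumes "loom r s (A, B)"
  shows "r \<ge> 1" "s \<ge> 1" "hypergraph A" "hypergraph B" "orthogonal (A, B)"
    "uniform r A" "uniform s B" "cover_number A = s" "cover_number B = r"
    "A = covers_of_size r B" "B = covers_of_size s A"
  using assms unfolding loom.simps by blast+

lemma loom_swap: "loom r s (A, B) \<Longrightarrow> loom s r (B, A)"
  unfolding loom.simps orthogonal.simps by (metis Int_commute)

text \<open>The empty set would cover an empty \<open>A\<close>, contradicting
  \<open>s \<ge> 1\<close>. Nonemptiness lets an edge be chosen from every member of a join.\<close>

lemma loom_nonempty:
  assumes "loom r s (A, B)"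
  shows "A \<noteq> {}"
proof
  assume "A = {}"
  then have "cover A {}"
    by (simp add: cover_def)
  then have "cover_number A \<le> 0"
    unfolding cover_number_def by (intro Least_le exI[of _ "{}"]) simp
  with loomD(2,8)[OF assms] show False
    by simp
qed

text \<open>Each edge of one side is a cover of the other side, hence lies inside its vertex
  set.\<close>

lemma loom_Union:
  assumes "loom r s (A, B)"
  shows "\<Union>A = \<Union>B"
proof -
  have "\<forall>a\<in>A. a \<subseteq> \<Union>B" "\<forall>b\<in>B. b \<subseteq> \<Union>A"
    using loomD(10,11)[OF assms] unfolding covers_of_size_def cover_def by blast+
  then show ?thesis
    by blast
qed

lemma loom_cover_ge:
  assumes "loom r s (A, B)" "cover A K"
  shows "s \<le> card K"
proof -
  have "cover_number A \<le> card K"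
    unfolding cover_number_def using assms(2) by (blast intro: Least_le)
  with loomD(8)[OF assms(1)] show ?thesis
    by simp
qed

lemma loom_edge_iff: "loom r s (A, B) \<Longrightarrow> b \<in> B \<longleftrightarrow> cover A b \<and> card b = s"
  by (drule loomD(11)) (simp add: covers_of_size_def set_eq_iff)

lemma ex_minimal_cover:
  assumes "finite K" "cover H K"
  shows "\<exists>K'\<subseteq>K. minimal_cover H K'"
  using assms
proof (induction K rule: finite_psubset_induct)
  case (psubset K)
  then show ?case
    unfolding minimal_cover_def by (meson order_refl psubset_imp_subset subset_trans)
qed

section \<open>Joins\<close>

lemma join_nonempty: "(\<And>i. i \<in> I \<Longrightarrow> H i \<noteq> {}) \<Longrightarrow> join I H \<noteq> {}"
  unfolding join_def using bchoice[of I "\<lambda>i e. e \<in> H i"] by blast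

lemma Union_join:
  assumes "\<And>i. i \<in> I \<Longrightarrow> H i \<noteq> {}"
  shows "\<Union>(join I H) = (\<Union>i\<in>I. \<Union>(H i))"
proof
  show "\<Union>(join I H) \<subseteq> (\<Union>i\<in>I. \<Union>(H i))"
    unfolding join_def by blast
  show "(\<Union>i\<in>I. \<Union>(H i)) \<subseteq> \<Union>(join I H)"
  proof
    fix x assume "x \<in> (\<Union>i\<in>I. \<Union>(H i))"
    then obtain i e where i: "i \<in> I" "e \<in> H i" "x \<in> e"
      by blast
    obtain g where "\<forall>i\<in>I. g i \<in> H i"
      using bchoice[of I "\<lambda>i e. e \<in> H i"] assms by blast
    \<comment> \<open>An arbitrary choice of edges, redirected at \<open>i\<close> to the edge
      \<open>e\<close> through \<open>x\<close>.\<close>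
    then have "(\<Union>j\<in>I. (g(i := e)) j) \<in> join I H"
      unfolding join_def using i by (intro CollectI exI[of _ "g(i := e)"]) simp
    moreover have "x \<in> (\<Union>j\<in>I. (g(i := e)) j)"
      using i by (intro UN_I[of i]) simp_all
    ultimately show "x \<in> \<Union>(join I H)"
      by blast
  qed
qed

lemma card_join_edge:
  assumes "finite I" "disjoint_family_on (\<lambda>i. \<Union>(H i)) I"
    and "\<And>i. i \<in> I \<Longrightarrow> hypergraph (H i)" "\<And>i. i \<in> I \<Longrightarrow> uniform (k i) (H i)"
    and "e \<in> join I H"
  shows "card e = (\<Sum>i\<in>I. k i)"
proof -
  obtain g where g: "e = (\<Union>i\<in>I. g i)" "\<forall>i\<in>I. g i \<in> H i"
    using assms(5) by (auto simp: join_def)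
  have "card e = (\<Sum>i\<in>I. card (g i))"
    unfolding g(1)
  proof (rule card_UN_disjoint)
    show "\<forall>i\<in>I. \<forall>j\<in>I. i \<noteq> j \<longrightarrow> g i \<inter> g j = {}"
      using assms(2) g(2) unfolding disjoint_family_on_def by blast
    show "\<forall>i\<in>I. finite (g i)"
      using assms(3) g(2) by (simp add: hypergraph_def)
  qed fact
  also have "\<dots> = (\<Sum>i\<in>I. k i)"
    using assms(4) g(2) by (intro sum.cong) (simp_all add: uniform_def)
  finally show ?thesis .
qed

text \<open>By disjointness of the sets \<open>V i\<close>, a common point of \<open>e\<close> and
  \<open>f\<close> comes from the same index on both sides. Only one index \<open>k\<close> is
  shared, so the intersection is that of an edge of \<open>P k\<close> with an edge of
  \<open>Q k\<close>.\<close>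

lemma card_join_Int_join:
  assumes "card (a \<inter> b) = 1" "disjoint_family_on V (a \<union> b)"
    and "\<And>i. i \<in> a \<Longrightarrow> \<Union>(P i) \<subseteq> V i" "\<And>i. i \<in> b \<Longrightarrow> \<Union>(Q i) \<subseteq> V i"
    and "\<And>i. i \<in> a \<inter> b \<Longrightarrow> orthogonal (P i, Q i)"
    and "e \<in> join a P" "f \<in> join b Q"
  shows "card (e \<inter> f) = 1"
proof -
  obtain g where g: "e = (\<Union>i\<in>a. g i)" "\<forall>i\<in>a. g i \<in> P i"
    using assms(6) by (auto simp: join_def)
  obtain h where h: "f = (\<Union>i\<in>b. h i)" "\<forall>i\<in>b. h i \<in> Q i"
    using assms(7) by (auto simp: join_def)
  obtain k where k: "a \<inter> b = {k}"
    using assms(1) by (auto simp: card_1_singleton_iff)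
  have *: "i = k \<and> j = k" if "i \<in> a" "j \<in> b" "x \<in> g i" "x \<in> h j" for i j x
  proof -
    have "x \<in> V i" "x \<in> V j"
      using that assms(3,4) g(2) h(2) by blast+
    then have "i = j"
      using that assms(2) unfolding disjoint_family_on_def by blast
    then show ?thesis
      using that k by blast
  qed
  have "e \<inter> f \<subseteq> g k \<inter> h k"
  proof
    fix x assume "x \<in> e \<inter> f"
    then obtain i j where ij: "i \<in> a" "j \<in> b" "x \<in> g i" "x \<in> h j"
      unfolding g(1) h(1) by blast
    then show "x \<in> g k \<inter> h k"
      using *[OF ij] by simp
  qed
  moreover have "g k \<inter> h k \<subseteq> e \<inter> f"
    unfolding g(1) h(1) using k by blast
  ultimately have "e \<inter> f = g k \<inter> h k"
    by blast
  moreover have "k \<in> a" "k \<in> b"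
    using k by blast+
  ultimately show ?thesis
    using assms(5)[of k] g(2) h(2) by simp
qed

section \<open>Blow-ups of looms\<close>

lemma cover_blow_up_traces:
  assumes "cover (\<Union>a\<in>A. join a P) K"
  shows "cover A {i \<in> \<Union>A. cover (P i) (K \<inter> \<Union>(P i))}"
  unfolding cover_def[of A]
proof (intro conjI ballI)
  let ?F = "{i \<in> \<Union>A. cover (P i) (K \<inter> \<Union>(P i))}"
  show "?F \<subseteq> \<Union>A"
    by blast
  fix a assume a: "a \<in> A"
  show "?F \<inter> a \<noteq> {}"
  proof
    assume "?F \<inter> a = {}"
    \<comment> \<open>The trace lies in \<open>\<Union>(P i)\<close> by construction, so it can fail
      to be a cover only by missing an edge; that edge lies in \<open>\<Union>(P i)\<close>, so
      \<open>K\<close> misses it too.\<close>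
    then have "\<forall>i\<in>a. \<exists>e. e \<in> P i \<and> K \<inter> e = {}"
      using a unfolding cover_def by blast
    then obtain g where g: "\<forall>i\<in>a. g i \<in> P i \<and> K \<inter> g i = {}"
      by (rule bchoice[THEN exE])
    then have "(\<Union>i\<in>a. g i) \<in> (\<Union>a\<in>A. join a P)"
      using a unfolding join_def by blast
    then have "K \<inter> (\<Union>i\<in>a. g i) \<noteq> {}"
      using assms unfolding cover_def by blast
    with g show False
      by blast
  qed
qed

text \<open>The assumptions persist when \<open>A\<close>, \<open>P\<close>, \<open>r\<close> are
  exchanged with \<open>B\<close>, \<open>Q\<close>, \<open>s\<close>, since the two sides of a loom
  have the same vertex set. Each result below thus serves both halves of the theorem.\<close>

context
  fixes A B :: "'i set set" and P Q :: "'i \<Rightarrow> 'a set set" and r s :: "'i \<Rightarrow> nat"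
  assumes fin: "finite (\<Union>A)"
    and Un_eq: "\<Union>A = \<Union>B"
    and ne: "\<Union>A \<noteq> {}"
    and orth: "orthogonal (A, B)"
    and all_looms: "\<forall>i\<in>\<Union>A. loom (r i) (s i) (P i, Q i)"
    and disj: "disjoint_family_on (\<lambda>i. \<Union>(P i)) (\<Union>A)"
begin

abbreviation (input) "\<C> \<equiv> (\<Union>a\<in>A. join a P)"
abbreviation (input) "\<D> \<equiv> (\<Union>b\<in>B. join b Q)"

lemmas looms = all_looms[rule_format]

lemma Union_members: "i \<in> \<Union>A \<Longrightarrow> \<Union>(Q i) = \<Union>(P i)"
  using loom_Union[OF looms] by simp

lemma Union_blow_up: "\<Union>\<C> = (\<Union>i\<in>\<Union>A. \<Union>(P i))"
proof -
  have "\<Union>(join a P) = (\<Union>i\<in>a. \<Union>(P i))" if "a \<in> A" for a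
    by (rule Union_join) (use that loom_nonempty[OF looms] in blast)
  then have "(\<Union>a\<in>A. \<Union>(join a P)) = (\<Union>a\<in>A. \<Union>i\<in>a. \<Union>(P i))"
    by (rule SUP_cong[OF refl])
  moreover have "\<Union>\<C> = (\<Union>a\<in>A. \<Union>(join a P))"
    by blast
  moreover have "(\<Union>a\<in>A. \<Union>i\<in>a. \<Union>(P i)) = (\<Union>i\<in>\<Union>A. \<Union>(P i))"
    by blast
  ultimately show ?thesis
    by (simp only:)
qed

lemma finite_Union_blow_up: "finite (\<Union>\<C>)"
proof -
  have "finite (\<Union>(P i))" if "i \<in> \<Union>A" for i
    using loomD(3)[OF looms[OF that]] by (simp add: hypergraph_def)
  then show ?thesis
    unfolding Union_blow_up using fin by blast
qed

lemma hypergraph_blow_up: "hypergraph \<C>"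
  unfolding hypergraph_def
  using finite_Union_blow_up by (meson finite_UnionD Union_upper finite_subset)

lemma orthogonal_blow_up: "orthogonal (\<C>, \<D>)"
proof -
  have "card (e \<inter> f) = 1" if "a \<in> A" "b \<in> B" "e \<in> join a P" "f \<in> join b Q" for a b e f
  proof (rule card_join_Int_join[where V = "\<lambda>i. \<Union>(P i)"])
    have sub: "a \<subseteq> \<Union>A" "b \<subseteq> \<Union>A"
      using that Un_eq by blast+
    show "card (a \<inter> b) = 1"
      using orth that by simp
    show "disjoint_family_on (\<lambda>i. \<Union>(P i)) (a \<union> b)"
      using disj by (rule disjoint_family_on_mono[rotated]) (use sub in blast)
    show "\<Union>(Q i) \<subseteq> \<Union>(P i)" if "i \<in> b" for i
      using Union_members that sub by blast
    show "orthogonal (P i, Q i)" if "i \<in> a \<inter> b" for i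
      using loomD(5)[OF looms[of i]] that sub by blast
  qed (use that in auto)
  then show ?thesis
    by auto
qed

lemma card_blow_up_edge:
  assumes "b \<in> B" "e \<in> join b Q"
  shows "card e = (\<Sum>i\<in>b. s i)"
proof (rule card_join_edge[OF _ _ _ _ assms(2)])
  have sub: "b \<subseteq> \<Union>A"
    using assms(1) Un_eq by blast
  show "finite b"
    using sub fin by (rule finite_subset)
  show "disjoint_family_on (\<lambda>i. \<Union>(Q i)) b"
    using disj sub Union_members unfolding disjoint_family_on_def by (metis subsetD)
  show "hypergraph (Q i)" "uniform (s i) (Q i)" if "i \<in> b" for i
    using loomD(4,7)[OF looms[of i]] sub that by blast+
qed

lemma join_B_nonempty: "b \<in> B \<Longrightarrow> join b Q \<noteq> {}"
  by (rule join_nonempty) (use Un_eq loom_nonempty[OF loom_swap[OF looms]] in blast)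

lemma blow_up_nonempty: "\<D> \<noteq> {}"
proof -
  obtain b where "b \<in> B"
    using ne Un_eq by blast
  with join_B_nonempty[OF this] show ?thesis
    by blast
qed

text \<open>Turns uniformity of the blow-up into a condition on the weights \<open>s\<close>: the
  nonempty \<open>join b Q\<close> supplies an edge whose size is both numbers.\<close>

lemma blow_up_edge_sum:
  assumes "uniform d \<D>" "b \<in> B"
  shows "(\<Sum>i\<in>b. s i) = d"
proof -
  obtain e where "e \<in> join b Q"
    using join_B_nonempty[OF assms(2)] by blast
  then show ?thesis
    using card_blow_up_edge[OF assms(2)] assms unfolding uniform_def by fastforce
qed

lemma blow_up_uniform_pos:
  assumes "uniform d \<D>"
  shows "d \<ge> 1"
proof -
  obtain i b where i: "i \<in> b" "b \<in> B"
    using ne Un_eq by blast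
  have "s i \<ge> 1"
    using loomD(2)[OF looms[of i]] i Un_eq by blast
  also have "s i \<le> (\<Sum>i\<in>b. s i)"
    by (rule member_le_sum) (use i Un_eq fin in \<open>auto intro: finite_subset[of b]\<close>)
  finally show ?thesis
    using blow_up_edge_sum[OF assms i(2)] by simp
qed

text \<open>Orthogonality makes \<open>f\<close> meet every edge, and the common vertex sets of the
  looms give the inclusion.\<close>

lemma blow_up_edge_covers:
  assumes "f \<in> \<D>"
  shows "cover \<C> f"
  unfolding cover_def
proof (intro conjI ballI)
  obtain b where b: "b \<in> B" "f \<in> join b Q"
    using assms by blast
  have "f \<subseteq> (\<Union>i\<in>b. \<Union>(Q i))"
    using b(2) unfolding join_def by blast
  also have "\<dots> \<subseteq> \<Union>\<C>"
    unfolding Union_blow_up using b(1) Un_eq Union_members by blast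
  finally show "f \<subseteq> \<Union>\<C>" .
  fix e assume "e \<in> \<C>"
  then have "card (e \<inter> f) = 1"
    using orthogonal_blow_up assms unfolding orthogonal.simps by blast
  then show "f \<inter> e \<noteq> {}"
    by (auto simp: Int_commute)
qed

lemma blow_up_minimum_covers:
  assumes unif: "uniform d \<D>"
    and min: "\<forall>f. minimal_cover A f \<and> f \<notin> B \<longrightarrow> (\<Sum>j\<in>f. s j) > d"
    and K: "cover \<C> K"
  shows "d \<le> card K" "card K = d \<Longrightarrow> K \<in> \<D>"
proof -
  let ?T = "\<lambda>i. K \<inter> \<Union>(P i)"
  let ?F = "{i \<in> \<Union>A. cover (P i) (?T i)}"
  have finK: "finite K"
    using K finite_Union_blow_up unfolding cover_def by (meson finite_subset)
  have "finite ?F"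
    by (rule finite_subset[OF _ fin]) blast
  then obtain f where f: "f \<subseteq> ?F" "minimal_cover A f"
    using ex_minimal_cover[OF _ cover_blow_up_traces[OF K]] by blast
  have finf: "finite f"
    using f(1) \<open>finite ?F\<close> by (rule finite_subset)
  have le: "s i \<le> card (?T i)" if "i \<in> f" for i
    using that f(1) looms loom_cover_ge by fast
  then have "(\<Sum>i\<in>f. s i) \<le> (\<Sum>i\<in>f. card (?T i))"
    by (rule sum_mono)
  moreover have UN: "(\<Sum>i\<in>f. card (?T i)) = card (\<Union>i\<in>f. ?T i)"
  proof (rule card_UN_disjoint[symmetric])
    show "\<forall>i\<in>f. \<forall>j\<in>f. i \<noteq> j \<longrightarrow> ?T i \<inter> ?T j = {}"
      using disj f(1) unfolding disjoint_family_on_def by blast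
  qed (use finf finK in auto)
  moreover have sub: "(\<Union>i\<in>f. ?T i) \<subseteq> K"
    by blast
  moreover have "card (\<Union>i\<in>f. ?T i) \<le> card K"
    using finK sub by (rule card_mono)
  ultimately have sum_le: "(\<Sum>i\<in>f. s i) \<le> card K"
    by linarith
  \<comment> \<open>If \<open>f \<in> B\<close>, uniformity gives equality; otherwise
    \<open>min\<close> gives a strict inequality.\<close>
  have d_le: "d \<le> (\<Sum>i\<in>f. s i)"
    using min f(2) blow_up_edge_sum[OF unif, of f] by (metis less_imp_le order_refl)
  with sum_le show "d \<le> card K"
    by simp
  assume eq: "card K = d"
  then have fB: "f \<in> B"
    using min f(2) sum_le by fastforce
  \<comment> \<open>The chain from \<open>d\<close> through the two sums to
    \<open>card K = d\<close> collapses, so all its inequalities are equalities.\<close>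
  have sums: "(\<Sum>i\<in>f. s i) = (\<Sum>i\<in>f. card (?T i))" "card (\<Union>i\<in>f. ?T i) = card K"
    using \<open>(\<Sum>i\<in>f. s i) \<le> (\<Sum>i\<in>f. card (?T i))\<close> \<open>card (\<Union>i\<in>f. ?T i) \<le> card K\<close> UN d_le eq
    by linarith+
  have "K = (\<Union>i\<in>f. ?T i)"
    using card_subset_eq[OF finK sub sums(2)] by simp
  moreover have "?T i \<in> Q i" if i: "i \<in> f" for i
  proof -
    \<comment> \<open>Equal sums of termwise comparable numbers agree term by term. The trace is
      then a cover of minimum size, which in a loom is an edge of \<open>Q i\<close>.\<close>
    have "s i = card (?T i)"
      using sum_mono_inv[OF sums(1) le i finf] .
    moreover have "i \<in> \<Union>A" "cover (P i) (?T i)"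
      using f(1) i by blast+
    ultimately show ?thesis
      using loom_edge_iff[OF looms] by metis
  qed
  ultimately have "K \<in> join f Q"
    unfolding join_def by blast
  with fB show "K \<in> \<D>"
    by blast
qed

lemma blow_up_covers_of_size:
  assumes "uniform d \<D>"
    and "\<forall>f. minimal_cover A f \<and> f \<notin> B \<longrightarrow> (\<Sum>j\<in>f. s j) > d"
  shows "\<D> = covers_of_size d \<C>" "cover_number \<C> = d"
proof -
  note minimum = blow_up_minimum_covers[OF assms]
  have card: "card e = d" if "e \<in> \<D>" for e
    using assms(1) that unfolding uniform_def by blast
  show "\<D> = covers_of_size d \<C>"
    unfolding covers_of_size_def
    using blow_up_edge_covers card minimum(2) by blast
  show "cover_number \<C> = d"
    unfolding cover_number_def
  proof (rule Least_equality)
    \<comment> \<open>Any edge of \<open>\<D>\<close> attains the minimum.\<close>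
    show "\<exists>K. cover \<C> K \<and> card K = d"
      using blow_up_nonempty blow_up_edge_covers card by blast
  qed (use minimum(1) in blast)
qed

end

theorem theorem5p6:
  fixes n c d :: nat
    and A B :: "nat set set"
    and L :: "nat \<Rightarrow> 'a set set \<times> 'a set set"
    and r s :: "nat \<Rightarrow> nat"
    and C D :: "'a set set"
  assumes "n \<ge> 1"
    and "hypergraph A" and "hypergraph B"
    and "orthogonal (A, B)"
    and "\<Union>A = {1..n}" and "\<Union>B = {1..n}"
    and "\<And>i. i \<in> {1..n} \<Longrightarrow> loom (r i) (s i) (L i)"
    and "disjoint_family_on (\<lambda>i. loom_vertices (L i)) {1..n}"
    and "(C, D) = blow_up (A, B) L"
    and "uniform c C" and "uniform d D"
    and "\<And>f. minimal_cover A f \<Longrightarrow> f \<notin> B \<Longrightarrow> (\<Sum>j\<in>f. s j) > d"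
    and "\<And>e. minimal_cover B e \<Longrightarrow> e \<notin> A \<Longrightarrow> (\<Sum>i\<in>e. r i) > c"
  shows "loom c d (C, D)"
proof -
  define P where "P = (\<lambda>i. fst (L i))"
  define Q where "Q = (\<lambda>i. snd (L i))"
  have C: "C = (\<Union>a\<in>A. join a P)" and D: "D = (\<Union>b\<in>B. join b Q)"
    using assms(9) by (simp_all add: P_def Q_def)
  have looms: "\<forall>i\<in>\<Union>A. loom (r i) (s i) (P i, Q i)"
    using assms(5,7) by (simp add: P_def Q_def)
  then have looms': "\<forall>i\<in>\<Union>B. loom (s i) (r i) (Q i, P i)"
    unfolding assms(5,6) by (blast intro: loom_swap)
  have disj: "disjoint_family_on (\<lambda>i. \<Union>(P i)) (\<Union>A)"
    using assms(5,8) by (simp add: P_def loom_vertices_def)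
  have disj': "disjoint_family_on (\<lambda>i. \<Union>(Q i)) (\<Union>B)"
    using disj loom_Union[OF looms[rule_format]] unfolding assms(5,6) disjoint_family_on_def by simp
  have base: "finite (\<Union>A)" "\<Union>A = \<Union>B" "\<Union>A \<noteq> {}"
    using assms(1,5,6) by simp_all
  have base': "finite (\<Union>B)" "\<Union>B = \<Union>A" "\<Union>B \<noteq> {}"
    using assms(1,5,6) by simp_all
  have orth': "orthogonal (B, A)"
    using assms(4) unfolding orthogonal.simps by (metis Int_commute)
  have large: "\<forall>f. minimal_cover A f \<and> f \<notin> B \<longrightarrow> (\<Sum>j\<in>f. s j) > d"
    and large': "\<forall>e. minimal_cover B e \<and> e \<notin> A \<longrightarrow> (\<Sum>i\<in>e. r i) > c"
    using assms(12,13) by blast+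
  \<comment> \<open>The context is instantiated twice: \<open>facts\<close> describes
    \<open>D\<close> as the minimum covers of \<open>C\<close>, and \<open>facts'\<close>, with the
    roles exchanged, describes \<open>C\<close> as those of \<open>D\<close>.\<close>
  note facts = base assms(4) looms disj and facts' = base' orth' looms' disj'
  have "hypergraph C" "hypergraph D" "orthogonal (C, D)"
    using hypergraph_blow_up[OF facts] hypergraph_blow_up[OF facts'] orthogonal_blow_up[OF facts]
    unfolding C D .
  moreover have "D = covers_of_size d C" "cover_number C = d" "d \<ge> 1"
    using blow_up_covers_of_size[OF facts assms(11)[unfolded D] large]
      blow_up_uniform_pos[OF facts assms(11)[unfolded D]]
    unfolding C D .
  moreover have "C = covers_of_size c D" "cover_number D = c" "c \<ge> 1"
    using blow_up_covers_of_size[OF facts' assms(10)[unfolded C] large']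
      blow_up_uniform_pos[OF facts' assms(10)[unfolded C]]
    unfolding C D .
  ultimately show ?thesis
    using assms(10,11) unfolding loom.simps by blast
qed

end
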